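(* Let $T$ be a reduced plane tree. The mould associated with $T$ is $$\mathcal{M}_T(Z):=\sum_{\mathcal{T}(u)=T}M_u(Z)=\prod_{\bullet\in T}\frac{1}{H_\bullet(Z)},$$ where the sum is over packed words $u$ with $\mathcal{T}(u)=T$, the product is over the internal nodes $\bullet$ of $T$, and $$H_\bullet(Z)=\Bigl(\prod_{z\in V(T_\bullet)}z\Bigr)-1,$$ where $T_\bullet$ is the subtree of $T$ with root $\bullet$ and $V(T_\bullet)$ is the set of the variables labeling its sectors.
   Context: A reduced plane tree is a plane rooted tree in which each vertex that is not a leaf has at least two children. A sector of $T$ is the gap between two consecutive children of an internal vertex; a tree with $n+1$ leaves has $n$ sectors, which are labeled $z_1,\dots,z_n$ from left to right (the $i$-th sector lies between the $i$-th and $(i+1)$-th leaves). A word $u$ of length $n$ over the positive integers is packed if its set of letters is $\{1,\dots,m\}$ for some $m$; let $B_k$ be the set of positions of the letter $k$ in $u$, and $z^I=\prod_{i\in I}z_i$. Then $M_u(Z)=\prod_{k=1}^m\bigl(\prod_{i=1}^kz^{B_i}-1\bigr)^{-1}\in\mathbb{C}(z_1,\dots,z_n)$. The map $\mathcal{T}$ from words to reduced plane trees is defined recursively: $\mathcal{T}$ of the empty word is the tree reduced to a single leaf; if $m=\max(w)$ has exactly $k\ge1$ occurrences in $w$, write $w=v_0\,m\,v_1\,m\,v_2\cdots v_{k-1}\,m\,v_k$ and let $\mathcal{T}(w)$ be obtained by grafting $\mathcal{T}(v_0),\mathcal{T}(v_1),\dots,\mathcal{T}(v_k)$, in this order, on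 a common root. *)

theory Defs
  imports Complex_Main "HOL-Library.Poly_Mapping" "HOL-Computational_Algebra.Fraction_Field"
begin

text \<open>
  Rational functions over the complex numbers in the variables \<open>z\<^sub>0, z\<^sub>1, z\<^sub>2, \<dots>\<close>: polynomials are
  finitely supported maps from monomials (finitely supported exponent vectors) to coefficients.
  This field contains \<open>\<complex>(z\<^sub>1, \<dots>, z\<^sub>n)\<close> for every \<open>n\<close>, so that no dimension has to be fixed.
\<close>

type_synonym ratfun = "((nat \<Rightarrow>\<^sub>0 nat) \<Rightarrow>\<^sub>0 complex) fract"

definition z :: "nat \<Rightarrow> ratfun" where
  "z i = Fract (Poly_Mapping.single (Poly_Mapping.single i 1) 1) 1"


section \<open>Plane trees\<close>

text \<open>The leaf is \<open>Node []\<close>.\<close>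

datatype plane_tree = Node (children: "plane_tree list")

fun reduced :: "plane_tree \<Rightarrow> bool" where
  "reduced (Node ts) \<longleftrightarrow> (ts = [] \<or> 2 \<le> length ts) \<and> (\<forall>t\<in>set ts. reduced t)"

fun num_leaves :: "plane_tree \<Rightarrow> nat" where
  "num_leaves (Node ts) = (if ts = [] then 1 else sum_list (map num_leaves ts))"

text \<open>
  A vertex is given by the path leading to it from the root: \<open>[]\<close> is the root and \<open>i # p\<close> is the
  vertex \<open>p\<close> of the \<open>i\<close>-th subtree of the root, where children are counted from 0.
\<close>

function vertices :: "plane_tree \<Rightarrow> nat list set" where
  "vertices (Node ts) = insert [] (\<Union>i\<in>{..<length ts}. (#) i ` vertices (ts ! i))"
  by pat_completeness auto
termination
  by (relation "measure size") (auto simp: less_Suc_eq_le intro!: size_list_estimation'[OF nth_mem])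

text \<open>The next two functions are meaningful for vertices of the tree only.\<close>

fun subtree :: "plane_tree \<Rightarrow> nat list \<Rightarrow> plane_tree" where
  "subtree t [] = t"
| "subtree t (i # p) = subtree (children t ! i) p"

text \<open>The number of leaves of the tree lying strictly to the left of the subtree rooted at a vertex.\<close>

fun leaves_before :: "plane_tree \<Rightarrow> nat list \<Rightarrow> nat" where
  "leaves_before t [] = 0"
| "leaves_before t (i # p) =
     (\<Sum>k<i. num_leaves (children t ! k)) + leaves_before (children t ! i) p"

definition internal_nodes :: "plane_tree \<Rightarrow> nat list set" where
  "internal_nodes t = {p \<in> vertices t. children (subtree t p) \<noteq> []}"

text \<open>The sector \<open>(p, j)\<close> is the gap between the children \<open>j\<close> and \<open>j + 1\<close> of the vertex \<open>p\<close>.\<close>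

definition sectors :: "plane_tree \<Rightarrow> (nat list \<times> nat) set" where
  "sectors t = {(p, j). p \<in> vertices t \<and> Suc j < length (children (subtree t p))}"

text \<open>
  A sector with exactly \<open>i\<close> leaves to its left lies between the \<open>i\<close>-th and the \<open>(i + 1)\<close>-th leaf
  (counted from 1), hence is the \<open>i\<close>-th sector from the left.  The leaves to the left of
  \<open>(p, j)\<close> are those to the left of the child \<open>j + 1\<close> of \<open>p\<close>.
\<close>

definition sector_index :: "plane_tree \<Rightarrow> nat list \<times> nat \<Rightarrow> nat" where
  "sector_index t = (\<lambda>(p, j). leaves_before t (p @ [Suc j]))"

text \<open>
  The labels are those of the whole tree \<open>t\<close>, so a sector \<open>(q, j)\<close> of the subtree rooted at \<open>p\<close>
  is regarded as the sector \<open>(p @ q, j)\<close> of \<open>t\<close>.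
\<close>

definition sector_vars :: "plane_tree \<Rightarrow> nat list \<Rightarrow> ratfun set" where
  "sector_vars t p = {z (sector_index t (p @ q, j)) | q j. (q, j) \<in> sectors (subtree t p)}"

definition H :: "plane_tree \<Rightarrow> nat list \<Rightarrow> ratfun" where
  "H t p = (\<Prod>x\<in>sector_vars t p. x) - 1"


section \<open>Packed words\<close>

definition packed :: "nat list \<Rightarrow> bool" where
  "packed u \<longleftrightarrow> (\<exists>m. set u = {1..m})"

text \<open>Positions are counted from 1.\<close>

definition positions :: "nat list \<Rightarrow> nat \<Rightarrow> nat set" where
  "positions u k = {i \<in> {1..length u}. u ! (i - 1) = k}"

definition z_prod :: "nat set \<Rightarrow> ratfun" where
  "z_prod I = (\<Prod>i\<in>I. z i)"

text \<open>For a packed word \<open>u\<close> with \<open>set u = {1..m}\<close> the number of letters \<open>card (set u)\<close> is \<open>m\<close>.\<close>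

definition M_word :: "nat list \<Rightarrow> ratfun" where
  "M_word u = (\<Prod>k=1..card (set u). inverse ((\<Prod>i=1..k. z_prod (positions u i)) - 1))"


section \<open>The tree of a word\<close>

text \<open>\<open>split_at m w\<close> is the list \<open>[v\<^sub>0, \<dots>, v\<^sub>k]\<close> with \<open>w = v\<^sub>0 m v\<^sub>1 m \<dots> m v\<^sub>k\<close> and no \<open>m\<close> in any \<open>v\<^sub>i\<close>.\<close>

fun split_at :: "'a \<Rightarrow> 'a list \<Rightarrow> 'a list list" where
  "split_at m [] = [[]]"
| "split_at m (x # w) =
     (if x = m then [] # split_at m w
      else (x # hd (split_at m w)) # tl (split_at m w))"

lemma split_at_nonempty: "split_at m w \<noteq> []"
  by (cases w) auto

lemma split_at_correct: "hd (split_at m w) @ concat (map ((#) m) (tl (split_at m w))) = w"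
proof (induction w)
  case (Cons x w)
  then show ?case
    using split_at_nonempty[of m w] by (cases "split_at m w") auto
qed simp

lemma split_at_not_in:
  assumes "v \<in> set (split_at m w)"
  shows "m \<notin> set v"
  using assms
proof (induction w arbitrary: v)
  case (Cons x w)
  then show ?case
    using split_at_nonempty[of m w]
    by (cases "split_at m w") (auto split: if_splits)
qed simp

lemma length_split_at: "length (split_at m w) = Suc (count_list w m)"
proof (induction w)
  case (Cons x w)
  then show ?case
    using split_at_nonempty[of m w] by (cases "split_at m w") auto
qed simp

lemma length_in_split_at:
  assumes "v \<in> set (split_at m w)"
  shows "length v \<le> length w"
  using assms
proof (induction w arbitrary: v)
  case (Cons x w)
  then show ?case
    using split_at_nonempty[of m w]
    by (cases "split_at m w") (fastforce split: if_splits)+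
qed simp

lemma length_in_split_at_less:
  assumes "v \<in> set (split_at m w)" and "m \<in> set w"
  shows "length v < length w"
  using assms
proof (induction w arbitrary: v)
  case (Cons x w)
  show ?case
  proof (cases "x = m")
    case True
    with Cons.prems(1) show ?thesis
      by (auto simp: less_Suc_eq_le length_in_split_at)
  next
    case False
    with Cons.prems(2) have m: "m \<in> set w" by simp
    from Cons.prems(1) False
    consider "v = x # hd (split_at m w)" | "v \<in> set (tl (split_at m w))"
      by auto
    then show ?thesis
    proof cases
      case 1
      with Cons.IH[OF _ m, of "hd (split_at m w)"] split_at_nonempty[of m w] show ?thesis
        by simp
    next
      case 2
      then have "v \<in> set (split_at m w)"
        by (meson list.set_sel(2) split_at_nonempty)
      from Cons.IH[OF this m] show ?thesis by simp
    qed
  qed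
qed simp

function tree_of_word :: "nat list \<Rightarrow> plane_tree" where
  "tree_of_word w =
     (if w = [] then Node [] else Node (map tree_of_word (split_at (Max (set w)) w)))"
  by pat_completeness auto
termination
  by (relation "measure length") (auto intro: length_in_split_at_less)

declare tree_of_word.simps [simp del]

lemma num_leaves_tree_of_word: "num_leaves (tree_of_word w) = Suc (length w)"
proof (induction w rule: tree_of_word.induct)
  case (1 w)
  show ?case
  proof (cases "w = []")
    case True
    then show ?thesis by (simp add: tree_of_word.simps)
  next
    case False
    have len: "sum_list (map (\<lambda>v. Suc (length v)) (split_at m u)) = Suc (length u)" for m :: nat and u
    proof (induction u)
      case (Cons x u)
      then show ?case
        using split_at_nonempty[of m u] by (cases "split_at m u") auto
    qed simp
    have eq: "map (num_leaves \<circ> tree_of_word) (split_at (Max (set w)) w)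
        = map (\<lambda>v. Suc (length v)) (split_at (Max (set w)) w)"
      using 1[OF False] by (intro map_cong) auto
    have "sum_list (map (num_leaves \<circ> tree_of_word) (split_at (Max (set w)) w)) = Suc (length w)"
      unfolding eq by (rule len)
    with False show ?thesis
      by (simp add: tree_of_word.simps[of w] split_at_nonempty)
  qed
qed

text \<open>Hence the following sum is finite.\<close>

lemma finite_packed_words_of_tree: "finite {u. packed u \<and> tree_of_word u = t}"
proof (rule finite_subset)
  show "{u. packed u \<and> tree_of_word u = t}
      \<subseteq> {u. set u \<subseteq> {..num_leaves t} \<and> length u \<le> num_leaves t}"
  proof clarify
    fix u assume "packed u" and t: "t = tree_of_word u"
    then obtain m where m: "set u = {1..m}" by (auto simp: packed_def)
    have "m \<le> length u"
      using card_length[of u] m by simp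
    with m t show "set u \<subseteq> {..num_leaves (tree_of_word u)}
        \<and> length u \<le> num_leaves (tree_of_word u)"
      by (auto simp: num_leaves_tree_of_word)
  qed
  show "finite {u. set u \<subseteq> {..num_leaves t} \<and> length u \<le> num_leaves t}"
    by (rule finite_lists_length_le) simp
qed

definition mould :: "plane_tree \<Rightarrow> ratfun" where
  "mould t = (\<Sum>u | packed u \<and> tree_of_word u = t. M_word u)"

end

theory Submission
  imports Defs "HOL-Library.Prefix_Order" "HOL-Library.FuncSet"
begin

text \<open>
  Cutting a word at its largest letter, and the pieces at theirs, gives all sectors of a vertex of
  the resulting tree the same letter, larger than the letters of the vertices below it. So the
  packed words with tree \<open>T\<close> are the labelings of the internal vertices of \<open>T\<close> that strictly decrease
  away from the root and take exactly the values \<open>1, \<dots>, m\<close> (\<open>bij_labelings_words\<close>). If \<open>x\<^sub>p\<close> is the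
  product of the variables of the sectors at the vertex \<open>p\<close>, then \<open>M\<^sub>u\<close> is the product over \<open>k\<close> of the
  inverses of \<open>(\<Prod>f p \<le> k. x\<^sub>p) - 1\<close>, where \<open>f\<close> is the labeling of \<open>u\<close> (\<open>M_word_map\<close>). Also, \<open>H\<^sub>p + 1\<close> is
  the product of \<open>x\<^sub>q\<close> over the descendants \<open>q\<close> of \<open>p\<close>, including \<open>p\<close>.

  What remains is an identity about finite forests and arbitrary weights (\<open>sum_weight_forest\<close>).
  The vertices with the largest label form a nonempty set \<open>S\<close> of roots, and removing them from a
  forest \<open>I\<close> leaves a forest, which gives the recursion
  \<open>F I = (\<Sum>S\<noteq>{}. F (I - S)) / (prod x I - 1)\<close> for the sum \<open>F\<close> of the weights. The claimed
  product solves it: with \<open>h\<^sub>r + 1\<close> the product of \<open>x\<close> over the tree with root \<open>r\<close>, the sum over \<open>S\<close> of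
  \<open>\<Prod>r\<in>S. h\<^sub>r\<close> is \<open>(\<Prod>r. h\<^sub>r + 1) - 1 = prod x I - 1\<close>.
\<close>

section \<open>Packed decreasing labelings of a forest\<close>

text \<open>
  In a forest \<open>p \<le> q\<close> means that \<open>p\<close> is an ancestor of \<open>q\<close>, as for paths ordered by prefix. The
  labels decrease away from the roots because a vertex is labeled by the letter at which the word
  is cut there, and the pieces contain smaller letters only.
\<close>

definition decreasing_on :: "'a::order set \<Rightarrow> ('a \<Rightarrow> nat) \<Rightarrow> bool" where
  "decreasing_on I f \<longleftrightarrow> (\<forall>p\<in>I. \<forall>q\<in>I. p < q \<longrightarrow> f q < f p)"

text \<open>
  Labelings are \<^const>\<open>extensional\<close> so that each is counted once in a sum.
\<close>

definition packed_labelings :: "'a::order set \<Rightarrow> ('a \<Rightarrow> nat) set" where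
  "packed_labelings I = {f \<in> extensional I. (\<exists>m. f ` I = {1..m}) \<and> decreasing_on I f}"

text \<open>
  The shape of \<^const>\<open>M_word\<close>, with one variable per vertex in place of one per position. Only the
  chain of sublevel sets of \<open>f\<close> enters.
\<close>

definition labeling_weight :: "('a \<Rightarrow> 'b::field) \<Rightarrow> 'a set \<Rightarrow> ('a \<Rightarrow> nat) \<Rightarrow> 'b" where
  "labeling_weight x I f = (\<Prod>k=1..card (f ` I). inverse ((\<Prod>p | p \<in> I \<and> f p \<le> k. x p) - 1))"

definition roots :: "'a::order set \<Rightarrow> 'a set" where
  "roots I = {p \<in> I. \<forall>q\<in>I. q \<le> p \<longrightarrow> q = p}"

text \<open>
  For nonempty \<open>I\<close>, a packed labeling amounts to a nonempty set \<open>S\<close> of roots, carrying the largest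
  label, and a packed labeling \<open>g\<close> of what remains. The next two functions, with
  restriction to the complement, are the two directions of this correspondence.
\<close>

definition add_top :: "'a set \<Rightarrow> 'a set \<Rightarrow> ('a \<Rightarrow> nat) \<Rightarrow> 'a \<Rightarrow> nat" where
  "add_top I S g = (\<lambda>p\<in>I. if p \<in> S then Suc (card (g ` (I - S))) else g p)"

definition top_set :: "'a set \<Rightarrow> ('a \<Rightarrow> nat) \<Rightarrow> 'a set" where
  "top_set I f = {p \<in> I. f p = card (f ` I)}"

lemma image_packed_labeling:
  assumes "f \<in> packed_labelings I"
  shows "f ` I = {1..card (f ` I)}"
proof -
  obtain m where "f ` I = {1..m}"
    using assms by (auto simp: packed_labelings_def)
  then show ?thesis by simp
qed

lemma finite_packed_labelings:
  assumes "finite I"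
  shows "finite (packed_labelings I)"
proof (rule finite_subset)
  show "packed_labelings I \<subseteq> (I \<rightarrow>\<^sub>E {1..card I})"
  proof
    fix f assume f: "f \<in> packed_labelings I"
    have "f p \<in> {1..card I}" if "p \<in> I" for p
    proof -
      have "f p \<in> {1..card (f ` I)}"
        using image_packed_labeling[OF f] that by blast
      with card_image_le[OF assms, of f] show ?thesis by simp
    qed
    then show "f \<in> I \<rightarrow>\<^sub>E {1..card I}"
      using f by (auto simp: packed_labelings_def PiE_def)
  qed
  show "finite (I \<rightarrow>\<^sub>E {1..card I})"
    using assms by (intro finite_PiE) auto
qed

lemma image_add_top:
  assumes "S \<subseteq> I" "S \<noteq> {}" "g \<in> packed_labelings (I - S)"
  shows "add_top I S g ` I = {1..Suc (card (g ` (I - S)))}"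
proof -
  have "add_top I S g ` I = add_top I S g ` S \<union> add_top I S g ` (I - S)"
    using assms(1) by blast
  also have "add_top I S g ` S = {Suc (card (g ` (I - S)))}"
    using assms(1,2) by (force simp: add_top_def)
  also have "add_top I S g ` (I - S) = g ` (I - S)"
    by (auto simp: add_top_def)
  also have "\<dots> = {1..card (g ` (I - S))}"
    by (rule image_packed_labeling[OF assms(3)])
  finally show ?thesis by auto
qed

lemma add_top_packed:
  assumes "S \<subseteq> roots I" "S \<noteq> {}" "g \<in> packed_labelings (I - S)"
  shows "add_top I S g \<in> packed_labelings I"
proof -
  have SI: "S \<subseteq> I" using assms(1) by (auto simp: roots_def)
  have le: "g p \<le> card (g ` (I - S))" if "p \<in> I - S" for p
    using image_packed_labeling[OF assms(3)] that by fastforce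
  have dec: "decreasing_on (I - S) g"
    using assms(3) by (simp add: packed_labelings_def)
  have "add_top I S g q < add_top I S g p" if pq: "p \<in> I" "q \<in> I" "p < q" for p q
  proof -
    have "q \<notin> S" using pq assms(1) less_imp_le[OF pq(3)] by (auto simp: roots_def)
    with pq le[of q] dec show ?thesis
      by (auto simp: add_top_def decreasing_on_def less_Suc_eq_le)
  qed
  then show ?thesis
    using image_add_top[OF SI assms(2,3)]
    by (auto simp: packed_labelings_def decreasing_on_def add_top_def)
qed

lemma top_set_add_top:
  assumes "S \<subseteq> I" "S \<noteq> {}" "g \<in> packed_labelings (I - S)"
  shows "top_set I (add_top I S g) = S"
proof -
  have le: "g p \<le> card (g ` (I - S))" if "p \<in> I - S" for p
    using image_packed_labeling[OF assms(3)] that by fastforce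
  show ?thesis
    using assms(1) le unfolding top_set_def image_add_top[OF assms]
    by (fastforce simp: add_top_def split: if_splits)
qed

lemma restrict_add_top:
  assumes "g \<in> packed_labelings (I - S)"
  shows "restrict (add_top I S g) (I - S) = g"
  using assms
  by (auto simp: packed_labelings_def add_top_def fun_eq_iff extensional_def)

lemma
  assumes "I \<noteq> {}" "f \<in> packed_labelings I"
  shows top_set_nonempty: "top_set I f \<noteq> {}"
    and top_set_roots: "top_set I f \<subseteq> roots I"
    and image_remove_top: "f ` (I - top_set I f) = {1..card (f ` I) - 1}"
    and restrict_top_packed: "restrict f (I - top_set I f) \<in> packed_labelings (I - top_set I f)"
    and add_top_restrict: "add_top I (top_set I f) (restrict f (I - top_set I f)) = f"
proof -
  let ?m = "card (f ` I)"
  have im: "f ` I = {1..?m}" by (rule image_packed_labeling[OF assms(2)])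
  have m: "?m \<ge> 1" using im assms(1) by (cases "?m = 0") auto
  have mem: "?m \<in> f ` I" by (subst im) (use m in auto)
  then show "top_set I f \<noteq> {}" by (force simp: top_set_def)
  have dec: "decreasing_on I f" using assms(2) by (simp add: packed_labelings_def)
  have le: "f p \<le> ?m" if "p \<in> I" for p using im that by fastforce
  show "top_set I f \<subseteq> roots I"
  proof
    fix p assume p: "p \<in> top_set I f"
    have "q = p" if "q \<in> I" "q \<le> p" for q
    proof (rule ccontr)
      assume "q \<noteq> p"
      with that have "q < p" by simp
      with that p dec have "f p < f q" unfolding decreasing_on_def top_set_def by blast
      with p le[OF that(1)] show False by (simp add: top_set_def)
    qed
    with p show "p \<in> roots I" by (auto simp: top_set_def roots_def)
  qed
  have "f ` (I - top_set I f) = f ` I - {?m}" by (auto simp: top_set_def)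
  also have "\<dots> = {1..?m} - {?m}" using im by simp
  also have "\<dots> = {1..?m - 1}" by auto
  finally show im': "f ` (I - top_set I f) = {1..?m - 1}" .
  show "restrict f (I - top_set I f) \<in> packed_labelings (I - top_set I f)"
    using im' dec by (auto simp: packed_labelings_def decreasing_on_def)
  have "f \<in> extensional I" using assms(2) by (simp add: packed_labelings_def)
  then show "add_top I (top_set I f) (restrict f (I - top_set I f)) = f"
    using im' m by (auto simp: add_top_def fun_eq_iff top_set_def extensional_def)
qed

text \<open>
  The factor of the largest label is that of all of \<open>I\<close>, whatever \<open>S\<close> and \<open>g\<close> are; the smaller
  labels do not see \<open>S\<close>.
\<close>

lemma weight_add_top:
  assumes "S \<subseteq> I" "S \<noteq> {}" "g \<in> packed_labelings (I - S)"
  shows "labeling_weight x I (add_top I S g) = inverse (prod x I - 1) * labeling_weight x (I - S) g"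
proof -
  let ?m = "card (g ` (I - S))"
  have le: "g p \<le> ?m" if "p \<in> I - S" for p
    using image_packed_labeling[OF assms(3)] that by fastforce
  have card: "card (add_top I S g ` I) = Suc ?m"
    unfolding image_add_top[OF assms] by simp
  have top: "{p. p \<in> I \<and> add_top I S g p \<le> Suc ?m} = I"
    using le by (force simp: add_top_def)
  have lower: "{p. p \<in> I \<and> add_top I S g p \<le> k} = {p. p \<in> I - S \<and> g p \<le> k}"
    if "k \<in> {1..?m}" for k
    using that assms(1) by (auto simp: add_top_def)
  have "labeling_weight x I (add_top I S g) =
      inverse ((\<Prod>p | p \<in> I \<and> add_top I S g p \<le> Suc ?m. x p) - 1)
      * (\<Prod>k=1..?m. inverse ((\<Prod>p | p \<in> I \<and> add_top I S g p \<le> k. x p) - 1))"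
    unfolding labeling_weight_def card by (simp add: mult.commute)
  also have "\<dots> = inverse (prod x I - 1)
      * (\<Prod>k=1..?m. inverse ((\<Prod>p | p \<in> I - S \<and> g p \<le> k. x p) - 1))"
    unfolding top using lower by (intro arg_cong2[where f = "(*)"] prod.cong refl) simp
  finally show ?thesis by (simp add: labeling_weight_def)
qed

text \<open>
  Classifying the labelings of \<open>I\<close> by the set on which they are largest gives a recursion for the
  sum of their weights.
\<close>

lemma sum_weight_remove_top:
  assumes "finite I" "I \<noteq> {}"
  shows "(\<Sum>f\<in>packed_labelings I. labeling_weight x I f) =
    inverse (prod x I - 1) *
    (\<Sum>S\<in>Pow (roots I) - {{}}. \<Sum>g\<in>packed_labelings (I - S). labeling_weight x (I - S) g)"
proof -
  have fin: "finite (Pow (roots I) - {{}})"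
    using assms(1) by (simp add: roots_def)
  have sub: "S \<subseteq> I" if "S \<subseteq> roots I" for S using that by (auto simp: roots_def)
  have "(\<Sum>f\<in>packed_labelings I. labeling_weight x I f) =
    (\<Sum>(S, g)\<in>Sigma (Pow (roots I) - {{}}) (\<lambda>S. packed_labelings (I - S)).
      inverse (prod x I - 1) * labeling_weight x (I - S) g)"
  proof (rule sum.reindex_bij_witness[symmetric,
        where j = "\<lambda>(S, g). add_top I S g"
          and i = "\<lambda>f. (top_set I f, restrict f (I - top_set I f))"], goal_cases)
    case (1 a)
    then obtain S g where "a = (S, g)" "S \<subseteq> roots I" "S \<noteq> {}" "g \<in> packed_labelings (I - S)"
      by auto
    then show ?case by (simp add: sub top_set_add_top restrict_add_top)
  next
    case (2 a)
    then show ?case by (auto intro: add_top_packed)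
  next
    case (3 b)
    then show ?case by (simp add: add_top_restrict[OF assms(2)])
  next
    case (4 b)
    then show ?case
      using top_set_nonempty[OF assms(2)] top_set_roots[OF assms(2)] restrict_top_packed[OF assms(2)]
      by auto
  next
    case (5 a)
    then obtain S g where "a = (S, g)" "S \<subseteq> roots I" "S \<noteq> {}" "g \<in> packed_labelings (I - S)"
      by auto
    then show ?case by (simp add: sub weight_add_top)
  qed
  also have "\<dots> = (\<Sum>S\<in>Pow (roots I) - {{}}. \<Sum>g\<in>packed_labelings (I - S).
      inverse (prod x I - 1) * labeling_weight x (I - S) g)"
    using fin assms(1) by (subst sum.Sigma) (auto intro: finite_packed_labelings)
  finally show ?thesis by (simp add: sum_distrib_left)
qed

text \<open>
  A set closed under descendants is the union of the cones of descendants of its roots. The cones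
  are disjoint because the ancestors of a vertex form a chain.
\<close>

lemma prod_cones:
  fixes x :: "'a::order \<Rightarrow> 'b::comm_monoid_mult"
  assumes "finite I"
    and up: "\<And>p q. p \<in> I \<Longrightarrow> q \<in> N \<Longrightarrow> p \<le> q \<Longrightarrow> q \<in> I" and "I \<subseteq> N"
    and chain: "\<And>p p' q. p \<in> N \<Longrightarrow> p' \<in> N \<Longrightarrow> p \<le> q \<Longrightarrow> p' \<le> q \<Longrightarrow> p \<le> p' \<or> p' \<le> (p::'a)"
  shows "(\<Prod>r\<in>roots I. \<Prod>q | q \<in> N \<and> r \<le> q. x q) = prod x I"
proof -
  have I: "I = (\<Union>r\<in>roots I. {q \<in> N. r \<le> q})"
  proof
    show "I \<subseteq> (\<Union>r\<in>roots I. {q \<in> N. r \<le> q})"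
    proof
      fix q assume q: "q \<in> I"
      with finite_has_minimal2[OF assms(1) q] obtain r where "r \<in> I" "r \<le> q" "\<forall>p\<in>I. p \<le> r \<longrightarrow> r = p"
        by blast
      with q assms(3) show "q \<in> (\<Union>r\<in>roots I. {q \<in> N. r \<le> q})" by (auto simp: roots_def)
    qed
  qed (use up in \<open>auto simp: roots_def\<close>)
  have "prod x (\<Union>r\<in>roots I. {q \<in> N. r \<le> q}) = (\<Prod>r\<in>roots I. prod x {q \<in> N. r \<le> q})"
  proof (rule prod.UNION_disjoint)
    show "finite (roots I)" using assms(1) by (simp add: roots_def)
    show "\<forall>r\<in>roots I. finite {q \<in> N. r \<le> q}"
    proof
      fix r assume "r \<in> roots I"
      then have "{q \<in> N. r \<le> q} \<subseteq> I" using up by (auto simp: roots_def)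
      then show "finite {q \<in> N. r \<le> q}" using assms(1) finite_subset by blast
    qed
    show "\<forall>r\<in>roots I. \<forall>r'\<in>roots I. r \<noteq> r' \<longrightarrow> {q \<in> N. r \<le> q} \<inter> {q \<in> N. r' \<le> q} = {}"
    proof (intro ballI impI)
      fix r r' assume r: "r \<in> roots I" "r' \<in> roots I" "r \<noteq> r'"
      have "\<not> (r \<le> q \<and> r' \<le> q)" for q
        using chain[of r r' q] r assms(3) by (auto simp: roots_def)
      then show "{q \<in> N. r \<le> q} \<inter> {q \<in> N. r' \<le> q} = {}" by blast
    qed
  qed
  with I show ?thesis by simp
qed

text \<open>
  Write \<open>h\<^sub>p + 1\<close> for the product of \<open>x\<close> over the cone of \<open>p\<close>. By induction on \<open>I\<close>, removing a set
  \<open>S\<close> of roots multiplies the right-hand side by \<open>\<Prod>p\<in>S. h\<^sub>p\<close>. Summing over all nonempty \<open>S\<close> gives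
  \<open>(\<Prod>r\<in>roots I. h\<^sub>r + 1) - 1\<close>, which is \<open>prod x I - 1\<close> since the cones of the roots partition \<open>I\<close>.
  This cancels the factor in front of the recursion. The induction leaves the trees and runs
  over forests, which is why \<open>I\<close> is any set closed under descendants.
\<close>

theorem sum_weight_forest:
  fixes x :: "'a::order \<Rightarrow> 'b::field"
  assumes "finite N"
    and chain: "\<And>p p' q. p \<in> N \<Longrightarrow> p' \<in> N \<Longrightarrow> p \<le> q \<Longrightarrow> p' \<le> q \<Longrightarrow> p \<le> p' \<or> p' \<le> (p::'a)"
    and ne1: "\<And>J. J \<subseteq> N \<Longrightarrow> J \<noteq> {} \<Longrightarrow> prod x J \<noteq> 1"
    and I: "I \<subseteq> N" "\<And>p q. p \<in> I \<Longrightarrow> q \<in> N \<Longrightarrow> p \<le> q \<Longrightarrow> q \<in> I"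
  shows "(\<Sum>f\<in>packed_labelings I. labeling_weight x I f) =
    (\<Prod>p\<in>I. inverse ((\<Prod>q | q \<in> N \<and> p \<le> q. x q) - 1))"
proof -
  define h where "h p = (\<Prod>q | q \<in> N \<and> p \<le> q. x q) - 1" for p
  have h: "h p \<noteq> 0" if "p \<in> N" for p
    using ne1[of "{q \<in> N. p \<le> q}"] that by (auto simp: h_def)
  have "finite I" using I(1) assms(1) finite_subset by blast
  then have "(\<Sum>f\<in>packed_labelings I. labeling_weight x I f) = (\<Prod>p\<in>I. inverse (h p))"
    using I
  proof (induction I rule: finite_psubset_induct)
    case (psubset I)
    show ?case
    proof (cases "I = {}")
      case True
      have "packed_labelings {} = {\<lambda>p::'a. undefined}"
        by (auto simp: packed_labelings_def decreasing_on_def intro: exI[of _ 0])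
      with True show ?thesis by (simp add: labeling_weight_def)
    next
      case False
      have fr: "finite (roots I)" using psubset.hyps by (simp add: roots_def)
      have IH: "(\<Sum>g\<in>packed_labelings (I - S). labeling_weight x (I - S) g) =
          (\<Prod>p\<in>I. inverse (h p)) * prod h S" if S: "S \<in> Pow (roots I) - {{}}" for S
      proof -
        from S have SI: "S \<subseteq> I" and ne: "S \<noteq> {}" by (auto simp: roots_def)
        have "(\<Sum>g\<in>packed_labelings (I - S). labeling_weight x (I - S) g) = (\<Prod>p\<in>I - S. inverse (h p))"
        proof (rule psubset.IH)
          fix p q assume pq: "p \<in> I - S" "q \<in> N" "p \<le> q"
          then have "q \<in> I" using psubset.prems(2) by blast
          moreover have "q \<notin> S" using pq S by (auto simp: roots_def)
          ultimately show "q \<in> I - S" by blast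
        qed (use SI ne psubset.prems(1) in auto)
        also have "\<dots> = (\<Prod>p\<in>I. inverse (h p)) * prod h S"
        proof -
          have "(\<Prod>p\<in>S. inverse (h p)) * prod h S = (\<Prod>p\<in>S. 1)"
            unfolding prod.distrib[symmetric] using h SI psubset.prems(1) by (intro prod.cong) auto
          moreover have "(\<Prod>p\<in>I. inverse (h p)) = (\<Prod>p\<in>I - S. inverse (h p)) * (\<Prod>p\<in>S. inverse (h p))"
            using prod.subset_diff[OF SI psubset.hyps] by simp
          ultimately show ?thesis by (simp add: mult.assoc)
        qed
        finally show ?thesis .
      qed
      have "(\<Sum>S\<in>Pow (roots I) - {{}}. prod h S) = (\<Sum>S\<in>Pow (roots I). prod h S) - 1"
        using fr by (subst sum_diff) auto
      also have "(\<Sum>S\<in>Pow (roots I). prod h S) = (\<Prod>r\<in>roots I. h r + 1)"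
        using prod_add[OF fr, of h "\<lambda>_. 1"] by simp
      also have "\<dots> = prod x I"
        using prod_cones[OF psubset.hyps psubset.prems(2) psubset.prems(1) chain, where x = x]
        by (simp add: h_def)
      finally have cancel: "(\<Sum>S\<in>Pow (roots I) - {{}}. prod h S) = prod x I - 1" .
      have "(\<Sum>f\<in>packed_labelings I. labeling_weight x I f) = inverse (prod x I - 1) *
          (\<Sum>S\<in>Pow (roots I) - {{}}. (\<Prod>p\<in>I. inverse (h p)) * prod h S)"
        unfolding sum_weight_remove_top[OF psubset.hyps False] using IH by simp
      also have "\<dots> = inverse (prod x I - 1) * ((\<Prod>p\<in>I. inverse (h p)) * (prod x I - 1))"
        by (simp only: sum_distrib_left[symmetric] cancel)
      also have "\<dots> = (\<Prod>p\<in>I. inverse (h p))"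
        using ne1[OF psubset.prems(1) False] by simp
      finally show ?thesis .
    qed
  qed
  then show ?thesis by (simp add: h_def)
qed

section \<open>Words cut at a letter\<close>

fun join :: "'a \<Rightarrow> 'a list list \<Rightarrow> 'a list" where
  "join s [] = []"
| "join s [xs] = xs"
| "join s (xs # ys # zss) = xs @ s # join s (ys # zss)"

lemma set_join: "set (join s xss) = (\<Union>xs\<in>set xss. set xs) \<union> (if 2 \<le> length xss then {s} else {})"
  by (induction s xss rule: join.induct) auto

lemma map_join: "map f (join s xss) = join (f s) (map (map f) xss)"
  by (induction s xss rule: join.induct) auto

lemma length_join: "xss \<noteq> [] \<Longrightarrow> Suc (length (join s xss)) = (\<Sum>k<length xss. Suc (length (xss ! k)))"
  by (induction s xss rule: join.induct) (auto simp: sum.lessThan_Suc_shift simp del: sum.lessThan_Suc)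

lemma join_split_at: "join m (split_at m w) = w"
proof (induction w)
  case (Cons a w)
  then show ?case
    using split_at_nonempty[of m w]
    by (cases "split_at m w" rule: list.exhaust; cases "tl (split_at m w)") auto
qed simp

lemma split_at_notin: "m \<notin> set xs \<Longrightarrow> split_at m xs = [xs]"
  by (induction xs) auto

lemma split_at_append: "m \<notin> set xs \<Longrightarrow> split_at m (xs @ m # w) = xs # split_at m w"
  by (induction xs) auto

lemma split_at_join: "xss \<noteq> [] \<Longrightarrow> \<forall>xs\<in>set xss. m \<notin> set xs \<Longrightarrow> split_at m (join m xss) = xss"
  by (induction m xss rule: join.induct) (auto simp: split_at_notin split_at_append)

text \<open>
  The graph of a list, with positions counted from 1 as in \<^const>\<open>positions\<close>. As a set it can be
  compared with the set of sectors of a tree without choosing an order on the sectors.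
\<close>

definition entries :: "'a list \<Rightarrow> (nat \<times> 'a) set" where
  "entries xs = {(Suc i, xs ! i) | i. i < length xs}"

lemma entries_Nil [simp]: "entries [] = {}"
  by (simp add: entries_def)

lemma entries_append_Cons:
  "entries (xs @ s # ys) =
    entries xs \<union> {(Suc (length xs), s)} \<union> map_prod ((+) (Suc (length xs))) id ` entries ys"
  (is "?L = ?R")
proof
  show "?L \<subseteq> ?R"
  proof
    fix e assume "e \<in> ?L"
    then obtain i where i: "i < length (xs @ s # ys)" and e: "e = (Suc i, (xs @ s # ys) ! i)"
      by (auto simp: entries_def)
    consider "i < length xs" | "i = length xs" | j where "i = length xs + Suc j"
      by (metis linorder_neqE_nat less_imp_Suc_add add_Suc_right)
    then show "e \<in> ?R"
    proof cases
      case 3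
      with i e have "(Suc j, ys ! j) \<in> entries ys" "e = map_prod ((+) (Suc (length xs))) id (Suc j, ys ! j)"
        by (auto simp: entries_def nth_append)
      then show ?thesis by blast
    qed (auto simp: e entries_def nth_append)
  qed
  have "(Suc (i + Suc (length xs)), ys ! i) \<in> entries (xs @ s # ys)" if "i < length ys" for i
    using that unfolding entries_def by (force simp: nth_append intro!: exI[of _ "i + Suc (length xs)"])
  then show "?R \<subseteq> ?L"
    by (force simp: entries_def nth_append add.commute)
qed

text \<open>
  Each piece but the last is followed by one separator, so the piece \<open>i\<close> is shifted by the sum of
  \<open>Suc (length _)\<close> over the earlier pieces. For the pieces coming from the subtrees of a root these
  numbers are the numbers of leaves.
\<close>

lemma entries_join:
  "entries (join s xss) =
    {(\<Sum>k<Suc j. Suc (length (xss ! k)), s) | j. Suc j < length xss} \<union>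
    (\<Union>i<length xss. map_prod ((+) (\<Sum>k<i. Suc (length (xss ! k)))) id ` entries (xss ! i))"
proof (induction s xss rule: join.induct)
  case (1 s)
  then show ?case by simp
next
  case (2 s xs)
  then show ?case by (simp add: map_prod.id lessThan_Suc)
next
  case (3 s xs ys zss)
  let ?r = "ys # zss"
  let ?sh = "map_prod ((+) (Suc (length xs))) id :: nat \<times> 'a \<Rightarrow> _"
  have shift: "(\<Sum>k<Suc j. Suc (length ((xs # ?r) ! k))) =
      Suc (length xs) + (\<Sum>k<j. Suc (length (?r ! k)))" for j
    by (subst sum.lessThan_Suc_shift) simp
  have comp: "(\<lambda>k. Suc (a + (b + k))) = (+) (Suc (a + b))" for a b :: nat by auto
  have zero: "(+) (0::nat) = (\<lambda>k. k)" by auto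
  have ident: "map_prod (\<lambda>k. k) (\<lambda>y. y) ` E = E" for E :: "(nat \<times> 'a) set"
    by (force simp: image_iff)
  have UN: "(\<Union>i<Suc n. P i) = P 0 \<union> (\<Union>i<n. P (Suc i))" for n and P :: "nat \<Rightarrow> (nat \<times> 'a) set"
    by (simp add: lessThan_Suc_eq_insert_0)
  have A: "{(\<Sum>k<Suc j. Suc (length ((xs # ?r) ! k)), s) | j. Suc j < length (xs # ?r)} =
      {(Suc (length xs), s)} \<union> ?sh ` {(\<Sum>k<Suc j. Suc (length (?r ! k)), s) | j. Suc j < length ?r}"
    (is "?A1 = ?A2")
  proof -
    have "?A1 = (\<lambda>j. (\<Sum>k<Suc j. Suc (length ((xs # ?r) ! k)), s)) ` {..<Suc (length zss)}"
      by auto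
    also have "\<dots> = insert (Suc (length xs), s) 
      ((\<lambda>j. (\<Sum>k<Suc (Suc j). Suc (length ((xs # ?r) ! k)), s)) ` {..<length zss})"
      unfolding lessThan_Suc_eq_insert_0 image_insert image_image shift by simp
    also have "\<dots> = ?A2"
      unfolding shift by (auto simp: image_iff simp del: sum.lessThan_Suc)
    finally show ?thesis .
  qed
  have "(\<Union>i<length (xs # ?r).
        map_prod ((+) (\<Sum>k<i. Suc (length ((xs # ?r) ! k)))) id ` entries ((xs # ?r) ! i)) =
      entries xs \<union> ?sh ` (\<Union>i<length ?r.
        map_prod ((+) (\<Sum>k<i. Suc (length (?r ! k)))) id ` entries (?r ! i))"
    by (subst length_Cons, subst UN) (simp add: shift zero ident comp id_def image_UN image_image
        map_prod.compositionality o_def add.assoc del: sum.lessThan_Suc length_Cons)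
  with A show ?case
    unfolding join.simps entries_append_Cons 3 image_Un by (simp only: Un_ac)
qed

section \<open>The vertices of the sectors, from left to right\<close>

text \<open>
  The list of the vertices to which the sectors belong, each vertex repeated once per sector. A
  word whose tree is \<open>T\<close> is obtained by mapping a labeling of the vertices over this list.
\<close>

function sector_nodes :: "plane_tree \<Rightarrow> nat list list" where
  "sector_nodes (Node ts) =
     join [] (map (\<lambda>i. map ((#) i) (sector_nodes (ts ! i))) [0..<length ts])"
  by pat_completeness auto
termination
  by (relation "measure size") (auto simp: less_Suc_eq_le intro!: size_list_estimation'[OF nth_mem])

lemma length_sector_nodes: "Suc (length (sector_nodes T)) = num_leaves T"
proof (induction T rule: sector_nodes.induct)
  case (1 ts)
  show ?case
  proof (cases "ts = []")
    case False
    then have "Suc (length (sector_nodes (Node ts))) = (\<Sum>k<length ts. num_leaves (ts ! k))"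
      using 1 by (simp add: length_join)
    also have "\<dots> = num_leaves (Node ts)"
      using False by (simp add: sum_list_sum_nth atLeast0LessThan)
    finally show ?thesis .
  qed simp
qed

lemma set_sector_nodes_Node:
  "set (sector_nodes (Node ts)) =
    (\<Union>i<length ts. (#) i ` set (sector_nodes (ts ! i))) \<union> (if 2 \<le> length ts then {[]} else {})"
  by (simp add: set_join atLeast0LessThan)

lemma internal_nodes_Node:
  "internal_nodes (Node ts) =
    (if ts = [] then {} else {[]}) \<union> (\<Union>i<length ts. (#) i ` internal_nodes (ts ! i))"
  by (auto simp: internal_nodes_def)

text \<open>
  An internal vertex with a single child would have no sector; reducedness excludes it.
\<close>

lemma set_sector_nodes:
  assumes "reduced T"
  shows "set (sector_nodes T) = internal_nodes T"
  using assms
proof (induction T rule: sector_nodes.induct)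
  case (1 ts)
  then show ?case
    unfolding set_sector_nodes_Node internal_nodes_Node by auto
qed

lemma sectors_Node:
  "sectors (Node ts) = {([], j) | j. Suc j < length ts} \<union>
    (\<Union>i<length ts. (\<lambda>(p, j). (i # p, j)) ` sectors (ts ! i))"
  by (auto simp: sectors_def image_iff)

lemma entries_map: "entries (map f xs) = map_prod id f ` entries xs"
  by (simp add: entries_def setcompr_eq_image image_image)

text \<open>
  The bridge between the two numberings: the sector with label \<open>i\<close> is the one at place \<open>i\<close> of
  the list. Both are computed by the same sums of numbers of leaves.
\<close>

lemma entries_sector_nodes:
  "entries (sector_nodes T) = (\<lambda>s. (sector_index T s, fst s)) ` sectors T"
proof (induction T rule: sector_nodes.induct)
  case (1 ts)
  let ?idx = "\<lambda>t s. (sector_index t s, fst s)"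
  let ?words = "map (\<lambda>i. map ((#) i) (sector_nodes (ts ! i))) [0..<length ts]"
  have len: "Suc (length (?words ! k)) = num_leaves (ts ! k)"
    if "k < length ts" for k
    using that by (simp add: length_sector_nodes)
  have sum: "(\<Sum>k<j. Suc (length (?words ! k))) = (\<Sum>k<j. num_leaves (ts ! k))"
    if "j \<le> length ts" for j
    using that by (intro sum.cong refl len) auto
  have "entries (sector_nodes (Node ts)) =
    {(\<Sum>k<Suc j. num_leaves (ts ! k), []) | j. Suc j < length ts} \<union>
    (\<Union>i<length ts. map_prod ((+) (\<Sum>k<i. num_leaves (ts ! k))) ((#) i) `
      entries (sector_nodes (ts ! i)))"
  proof -
    have a: "{(\<Sum>k<Suc j. Suc (length (?words ! k)), []) | j. Suc j < length ts}
      = {(\<Sum>k<Suc j. num_leaves (ts ! k), [] :: nat list) | j. Suc j < length ts}"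
      using sum by (metis (no_types, lifting) less_imp_le)
    show ?thesis
      unfolding sector_nodes.simps entries_join length_map length_upt diff_zero a
      by (intro arg_cong2[where f = "(\<union>)"] refl SUP_cong)
         (simp add: length_sector_nodes entries_map image_image map_prod.compositionality o_def del: sum.lessThan_Suc)
  qed
  also have "{(\<Sum>k<Suc j. num_leaves (ts ! k), []) | j. Suc j < length ts} =
      ?idx (Node ts) ` {([], j) | j. Suc j < length ts}"
    by (auto simp: sector_index_def image_iff simp del: sum.lessThan_Suc)
  also have "(\<Union>i<length ts. map_prod ((+) (\<Sum>k<i. num_leaves (ts ! k))) ((#) i) `
      entries (sector_nodes (ts ! i)))
      = (\<Union>i<length ts. ?idx (Node ts) ` (\<lambda>(p, j). (i # p, j)) ` sectors (ts ! i))"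
    by (intro SUP_cong refl) (simp add: 1 image_image sector_index_def case_prod_unfold)
  finally show ?case
    unfolding sectors_Node image_Un image_UN .
qed

lemma subtree_append: "subtree t (p @ q) = subtree (subtree t p) q"
  by (induction t p rule: subtree.induct) auto

lemma vertices_append:
  "p \<in> vertices t \<Longrightarrow> p @ q \<in> vertices t \<longleftrightarrow> q \<in> vertices (subtree t p)"
proof (induction p arbitrary: t)
  case (Cons i p)
  then show ?case by (cases t) auto
qed simp

lemma sectors_subtree:
  "p \<in> vertices t \<Longrightarrow> (q, j) \<in> sectors (subtree t p) \<longleftrightarrow> (p @ q, j) \<in> sectors t"
  by (simp add: sectors_def subtree_append vertices_append)

section \<open>Products of variables\<close>

definition places :: "'a list \<Rightarrow> 'a set \<Rightarrow> nat set" where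
  "places xs A = {i \<in> {1..length xs}. xs ! (i - 1) \<in> A}"

lemma places_entries: "places xs A = {i. \<exists>a\<in>A. (i, a) \<in> entries xs}"
proof -
  have "i \<in> places xs A \<longleftrightarrow> (\<exists>a\<in>A. (i, a) \<in> entries xs)" for i
    by (cases i) (auto simp: places_def entries_def)
  then show ?thesis by blast
qed

lemma finite_places [simp]: "finite (places xs A)"
  by (simp add: places_def)

lemma places_nonempty: "a \<in> set xs \<Longrightarrow> a \<in> A \<Longrightarrow> places xs A \<noteq> {}"
  by (fastforce simp: places_entries entries_def in_set_conv_nth)

lemma places_Int_set: "places xs A = places xs (set xs \<inter> A)"
  by (fastforce simp: places_def)

lemma positions_map: "positions (map f xs) k = places xs {a. f a = k}"
  by (fastforce simp: positions_def places_def)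

lemma z_prod_places:
  assumes "finite A"
  shows "z_prod (places xs A) = (\<Prod>a\<in>A. z_prod (places xs {a}))"
proof -
  have "places xs A = (\<Union>a\<in>A. places xs {a})" by (auto simp: places_def)
  then show ?thesis
    unfolding z_prod_def using assms
    by (simp, subst prod.UNION_disjoint) (auto simp: places_def)
qed

lemma sector_vars_places:
  assumes "p \<in> vertices T"
  shows "sector_vars T p = z ` places (sector_nodes T) {q. p \<le> q}"
proof -
  have "places (sector_nodes T) {q. p \<le> q} = sector_index T ` {(r, j) \<in> sectors T. p \<le> r}"
    unfolding places_entries entries_sector_nodes by force
  also have "\<dots> = {sector_index T (p @ q, j) | q j. (p @ q, j) \<in> sectors T}"
    unfolding less_eq_list_def prefix_def by blast
  finally show ?thesis
    unfolding sector_vars_def sectors_subtree[OF assms] by auto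
qed

lemma prod_z:
  assumes "finite A"
  shows "(\<Prod>i\<in>A. z i) =
    Fract (Poly_Mapping.single (\<Sum>i\<in>A. Poly_Mapping.single i 1) 1) 1"
  using assms by (induction A) (auto simp: z_def mult_single One_fract_def single_one)

lemma inj_z: "inj z"
proof (rule injI)
  fix i j assume "z i = z j"
  then have "Poly_Mapping.single (Poly_Mapping.single i (1::nat)) (1::complex) =
      Poly_Mapping.single (Poly_Mapping.single j 1) 1"
    by (simp add: z_def eq_fract)
  then show "i = j"
    by (metis lookup_single_eq lookup_single_not_eq zero_neq_one)
qed

text \<open>
  A nonconstant monomial differs from 1. Hence the denominators cancelled in the recursion for
  forests do not vanish.
\<close>

lemma z_prod_neq_1:
  assumes "finite A" "A \<noteq> {}"
  shows "z_prod A \<noteq> 1"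
proof
  let ?e = "\<Sum>i\<in>A. Poly_Mapping.single i (1::nat)"
  assume "z_prod A = 1"
  then have "Poly_Mapping.single ?e (1::complex) = Poly_Mapping.single 0 1"
    using prod_z[OF assms(1)] by (simp add: z_prod_def One_fract_def eq_fract single_one)
  then have "?e = 0"
    by (metis lookup_single_eq lookup_single_not_eq zero_neq_one)
  moreover obtain a where "a \<in> A" using assms(2) by blast
  then have "Poly_Mapping.lookup ?e a = 1"
    using assms(1) by (simp add: lookup_sum lookup_single when_def)
  ultimately show False by simp
qed

lemma H_places:
  assumes "p \<in> vertices T"
  shows "H T p = z_prod (places (sector_nodes T) {q. p \<le> q}) - 1"
  unfolding H_def sector_vars_places[OF assms] z_prod_def
  by (subst prod.reindex) (auto intro: inj_on_subset[OF inj_z])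

section \<open>The words of a tree are its decreasing labelings\<close>

text \<open>
  The root has the strictly largest label, and it has a sector because it has at least two
  children; so the word is cut exactly at the sectors of the root.
\<close>

lemma tree_of_word_map:
  assumes "reduced T" "decreasing_on (set (sector_nodes T)) f"
  shows "tree_of_word (map f (sector_nodes T)) = T"
  using assms
proof (induction T arbitrary: f rule: sector_nodes.induct)
  case (1 ts)
  show ?case
  proof (cases "ts = []")
    case True
    then show ?thesis by (simp add: tree_of_word.simps)
  next
    case False
    with "1.prems"(1) have two: "2 \<le> length ts" by simp
    let ?w = "map f (sector_nodes (Node ts))"
    let ?v = "\<lambda>i. map (\<lambda>p. f (i # p)) (sector_nodes (ts ! i))"
    have root: "[] \<in> set (sector_nodes (Node ts))"
      unfolding set_sector_nodes_Node using two by simp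
    have child: "i # p \<in> set (sector_nodes (Node ts))"
      if "i < length ts" "p \<in> set (sector_nodes (ts ! i))" for i p
      unfolding set_sector_nodes_Node using that by auto
    have less: "f q < f []" if "q \<in> set (sector_nodes (Node ts))" "q \<noteq> []" for q
      using "1.prems"(2) root that unfolding decreasing_on_def by (cases q) auto
    have w: "?w = join (f []) (map ?v [0..<length ts])"
      by (simp add: map_join o_def)
    have "Max (set ?w) = f []"
    proof (rule Max_eqI)
      fix y assume "y \<in> set ?w"
      then obtain q where "q \<in> set (sector_nodes (Node ts))" "y = f q" by auto
      then show "y \<le> f []" using less[of q] by (cases "q = []") auto
    qed (use root in auto)
    moreover have "split_at (f []) ?w = map ?v [0..<length ts]"
      unfolding w
    proof (rule split_at_join)
      show "\<forall>xs\<in>set (map ?v [0..<length ts]). f [] \<notin> set xs"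
        using less[OF child] by fastforce
    qed (use False in simp)
    moreover have "?w \<noteq> []" using root by auto
    ultimately have "tree_of_word ?w = Node (map (\<lambda>i. tree_of_word (?v i)) [0..<length ts])"
      by (simp add: tree_of_word.simps[of ?w] o_def del: sector_nodes.simps)
    also have "map (\<lambda>i. tree_of_word (?v i)) [0..<length ts] = map (\<lambda>i. ts ! i) [0..<length ts]"
    proof (intro map_cong refl)
      fix i assume i: "i \<in> set [0..<length ts]"
      show "tree_of_word (?v i) = ts ! i"
      proof (rule "1.IH"[OF i])
        show "reduced (ts ! i)" using i "1.prems"(1) by simp
        show "decreasing_on (set (sector_nodes (ts ! i))) (\<lambda>p. f (i # p))"
          using "1.prems"(2) child i unfolding decreasing_on_def by simp
      qed
    qed
    finally show ?thesis by (simp add: map_nth)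
  qed
qed

text \<open>
  Conversely, the positions of the maximal letter are the sectors of the root, so the root receives
  that letter, and the labels of the other vertices come from the pieces.
\<close>

lemma word_of_tree:
  "\<exists>f. decreasing_on (set (sector_nodes (tree_of_word u))) f \<and> map f (sector_nodes (tree_of_word u)) = u"
proof (induction u rule: tree_of_word.induct)
  case (1 u)
  show ?case
  proof (cases "u = []")
    case True
    then show ?thesis by (simp add: tree_of_word.simps decreasing_on_def)
  next
    case False
    define m where "m = Max (set u)"
    define vs where "vs = split_at m u"
    define ts where "ts = map tree_of_word vs"
    have T: "tree_of_word u = Node ts"
      using False by (simp add: tree_of_word.simps[of u] ts_def vs_def m_def)
    have u: "join m vs = u" by (simp add: vs_def join_split_at)
    have "\<exists>f. decreasing_on (set (sector_nodes (ts ! i))) f \<and> map f (sector_nodes (ts ! i)) = vs ! i"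
      if "i < length vs" for i
      using "1.IH"[OF False, of "vs ! i"] that by (simp add: ts_def vs_def m_def)
    then obtain F where
      F: "\<And>i. i < length vs \<Longrightarrow> decreasing_on (set (sector_nodes (ts ! i))) (F i)"
         "\<And>i. i < length vs \<Longrightarrow> map (F i) (sector_nodes (ts ! i)) = vs ! i"
      by metis
    \<comment> \<open>A vertex of the subtree \<open>i\<close> takes its label from the piece \<open>i\<close>.\<close>
    define f where "f q = (case q of [] \<Rightarrow> m | i # p \<Rightarrow> F i p)" for q
    have len: "length ts = length vs" by (simp add: ts_def)
    have "map f (sector_nodes (Node ts)) =
        join m (map (\<lambda>i. map (F i) (sector_nodes (ts ! i))) [0..<length vs])"
      by (simp add: map_join o_def f_def len)
    also have "map (\<lambda>i. map (F i) (sector_nodes (ts ! i))) [0..<length vs] =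
        map (\<lambda>i. vs ! i) [0..<length vs]"
      using F(2) by (intro map_cong refl) simp
    finally have fu: "map f (sector_nodes (Node ts)) = u"
      by (simp add: map_nth u)
    have less: "F i p < m" if i: "i < length vs" and p: "p \<in> set (sector_nodes (ts ! i))" for i p
    proof -
      have "F i p \<in> set (vs ! i)" unfolding F(2)[OF i, symmetric] using p by simp
      moreover have "vs ! i \<in> set vs" using i by simp
      ultimately have "F i p \<noteq> m" "F i p \<in> set (join m vs)"
        using split_at_not_in[of "vs ! i" m u] by (auto simp: vs_def set_join)
      then have "F i p \<noteq> m" "F i p \<in> set u" by (simp_all add: u)
      then show ?thesis unfolding m_def by (simp add: order_neq_le_trans)
    qed
    have "decreasing_on (set (sector_nodes (Node ts))) f"
      unfolding decreasing_on_def
    proof (intro ballI impI)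
      fix p q assume pq: "p \<in> set (sector_nodes (Node ts))" "q \<in> set (sector_nodes (Node ts))" "p < q"
      then obtain i q' where q: "q = i # q'" by (cases q) auto
      with pq(2) have q': "i < length vs" "q' \<in> set (sector_nodes (ts ! i))"
        unfolding set_sector_nodes_Node by (auto simp: len split: if_splits)
      show "f q < f p"
      proof (cases p)
        case Nil
        with q less[OF q'] show ?thesis by (simp add: f_def)
      next
        case (Cons i' p')
        with pq q have "i' = i" "p' < q'" by auto
        moreover from this pq(1) Cons have "p' \<in> set (sector_nodes (ts ! i))"
          unfolding set_sector_nodes_Node by (auto split: if_splits)
        ultimately show ?thesis
          using F(1)[OF q'(1)] q' by (simp add: f_def q Cons decreasing_on_def)
      qed
    qed
    with fu T show ?thesis by auto
  qed
qed

lemma bij_labelings_words: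
  assumes "reduced T"
  shows "bij_betw (\<lambda>f. map f (sector_nodes T)) (packed_labelings (set (sector_nodes T)))
    {u. packed u \<and> tree_of_word u = T}"
  unfolding bij_betw_def
proof
  let ?L = "sector_nodes T"
  show "inj_on (\<lambda>f. map f ?L) (packed_labelings (set ?L))"
    by (rule inj_onI) (auto simp: packed_labelings_def intro: extensionalityI)
  show "(\<lambda>f. map f ?L) ` packed_labelings (set ?L) = {u. packed u \<and> tree_of_word u = T}" (is "?A = ?B")
  proof
    show "?A \<subseteq> ?B"
      using tree_of_word_map[OF assms] by (auto simp: packed_labelings_def packed_def)
    show "?B \<subseteq> ?A"
    proof
      fix u assume "u \<in> ?B"
      then have u: "packed u" "tree_of_word u = T" by auto
      with word_of_tree[of u] obtain f where f: "decreasing_on (set ?L) f" "map f ?L = u" by auto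
      have mem: "restrict f (set ?L) \<in> packed_labelings (set ?L)"
        using f u(1) by (auto simp: packed_labelings_def packed_def decreasing_on_def)
      have "u = map (restrict f (set ?L)) ?L" using f(2) by auto
      with mem show "u \<in> ?A" by (rule rev_image_eqI[where f = "\<lambda>f. map f ?L"])
    qed
  qed
qed

text \<open>
  The letters at most \<open>k\<close> occupy the places of the vertices with label at most \<open>k\<close>.
\<close>

lemma M_word_map:
  assumes "f \<in> packed_labelings (set xs)"
  shows "M_word (map f xs) = labeling_weight (\<lambda>a. z_prod (places xs {a})) (set xs) f"
proof -
  have pos: "1 \<le> f a" if "a \<in> set xs" for a
    using image_packed_labeling[OF assms] that by fastforce
  have "(\<Prod>i=1..k. z_prod (positions (map f xs) i)) =
      (\<Prod>a | a \<in> set xs \<and> f a \<le> k. z_prod (places xs {a}))" for k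
  proof -
    have "(\<Prod>i=1..k. z_prod (positions (map f xs) i)) =
        (\<Prod>i=1..k. \<Prod>a | a \<in> {a \<in> set xs. f a \<le> k} \<and> f a = i. z_prod (places xs {a}))"
    proof (intro prod.cong refl)
      fix i assume "i \<in> {1..k}"
      then have *: "{a. a \<in> {a \<in> set xs. f a \<le> k} \<and> f a = i} = set xs \<inter> {a. f a = i}" by auto
      show "z_prod (positions (map f xs) i) =
          (\<Prod>a | a \<in> {a \<in> set xs. f a \<le> k} \<and> f a = i. z_prod (places xs {a}))"
        unfolding * positions_map by (subst places_Int_set, subst z_prod_places) auto
    qed
    also have "\<dots> = (\<Prod>a | a \<in> set xs \<and> f a \<le> k. z_prod (places xs {a}))"
      using pos by (intro prod.group) auto
    finally show ?thesis .
  qed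
  then show ?thesis by (simp add: M_word_def labeling_weight_def)
qed

section \<open>The mould of a tree\<close>

theorem theorem6p6:
  fixes T :: plane_tree
  assumes "reduced T"
  shows "mould T = (\<Prod>p\<in>internal_nodes T. 1 / H T p)"
proof -
  let ?L = "sector_nodes T"
  let ?x = "\<lambda>p. z_prod (places ?L {p})"
  have "mould T = (\<Sum>f\<in>packed_labelings (set ?L). M_word (map f ?L))"
    unfolding mould_def by (rule sum.reindex_bij_betw[OF bij_labelings_words[OF assms], symmetric])
  also have "\<dots> = (\<Sum>f\<in>packed_labelings (set ?L). labeling_weight ?x (set ?L) f)"
    by (intro sum.cong refl M_word_map)
  also have "\<dots> = (\<Prod>p\<in>set ?L. inverse ((\<Prod>q | q \<in> set ?L \<and> p \<le> q. ?x q) - 1))"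
  proof (rule sum_weight_forest)
    show "p \<le> p' \<or> p' \<le> p" if "p \<le> q" "p' \<le> q" for p p' q :: "nat list"
      using that prefix_same_cases unfolding less_eq_list_def by blast
    show "prod ?x J \<noteq> 1" if J: "J \<subseteq> set ?L" "J \<noteq> {}" for J
    proof -
      have "prod ?x J = z_prod (places ?L J)"
        using J(1) by (intro z_prod_places[symmetric]) (rule finite_subset, auto)
      also have "\<dots> \<noteq> 1"
        using J places_nonempty[of _ ?L J] by (intro z_prod_neq_1) auto
      finally show ?thesis .
    qed
  qed auto
  also have "\<dots> = (\<Prod>p\<in>internal_nodes T. 1 / H T p)"
  proof (rule prod.cong)
    show "set ?L = internal_nodes T" by (rule set_sector_nodes[OF assms])
    fix p assume "p \<in> internal_nodes T"
    then have "H T p = z_prod (places ?L {q. p \<le> q}) - 1"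
      by (intro H_places) (simp add: internal_nodes_def)
    also have "z_prod (places ?L {q. p \<le> q}) = (\<Prod>q | q \<in> set ?L \<and> p \<le> q. ?x q)"
      by (subst places_Int_set, subst z_prod_places) (auto simp: Collect_conj_eq)
    finally show "inverse ((\<Prod>q | q \<in> set ?L \<and> p \<le> q. ?x q) - 1) = 1 / H T p"
      by (simp add: inverse_eq_divide)
  qed
  finally show ?thesis .
qed

end
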